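(* Let $X$ be a Tychonoff space. The structure space $\mathcal{M}(B_1(X))$ of the ring $B_1(X)$ is homeomorphic to $\widetilde{X}$ with the Stone-topology.
   Context: $B_1(X)$ is the ring of Baire one functions on $X$, i.e. pointwise limits of sequences of continuous functions $X\to\mathbb{R}$. $\mathcal{M}(B_1(X))$ is the set of all maximal ideals of $B_1(X)$, with the hull-kernel topology: the sets $\widehat{\mathscr{M}_f}=\{\widehat{M}\in\mathcal{M}(B_1(X)): f\in\widehat{M}\}$, $f\in B_1(X)$, form a base for the closed sets; it is called the structure space of $B_1(X)$. For $f\in B_1(X)$, $Z(f)=\{x\in X: f(x)=0\}$, and $Z(B_1(X))=\{Z(f): f\in B_1(X)\}$. A $Z_B$-filter on $X$ is a nonempty family $\mathscr{F}\subseteq Z(B_1(X))$ with $\emptyset\notin\mathscr{F}$, closed under finite intersections, and such that $Z\in\mathscr{F}$, $Z'\in Z(B_1(X))$, $Z\subseteq Z'$ imply $Z'\in\mathscr{F}$. A $Z_B$-ultrafilter is a $Z_B$-filter that is maximal under inclusion. For $p\in X$, $\mathscr{U}_p=\{Z\in Z(B_1(X)): p\in Z\}$ is a $Z_B$-ultrafilter. The set $\widetilde{X}\supseteq X$ is an index set for the family of all $Z_B$-ultrafilters on $X$: $p\mapsto\mathscr{U}^p$ is a bijection from $\widetilde{X}$ onto the set of all $Z_B$-ultrafilters on $X$, with $\mathscr{U}^p=\mathscr{U}_p$ for $p\in X$. For $Z\in Z(B_1(X))$, $\overline{Z}=\{p\in\widetilde{X}: Z\in\mathscr{U}^p\}$.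 The Stone-topology on $\widetilde{X}$ is the topology having $\{\overline{Z}: Z\in Z(B_1(X))\}$ as a base for closed sets. *)

theory Defs
  imports "HOL-Analysis.Analysis" "HOL-Algebra.Ideal"
begin

text \<open>This is a topology on \<open>S\<close> with base \<open>\<C>\<close> of closed sets when \<open>\<C>\<close> contains \<open>{}\<close> and is closed under
  binary unions (see \<open>closedin_closed_base_topology\<close>). Both conditions are verified for the two
  instances \<open>structure_space\<close> and \<open>stone_topology\<close>.\<close>

definition closed_base_topology :: "'a set \<Rightarrow> 'a set set \<Rightarrow> 'a topology" where
  "closed_base_topology S \<C> = topology (arbitrary union_of (\<lambda>U. \<exists>K\<in>\<C>. U = S - K))"

lemma openin_closed_base_topology:
  assumes "\<And>K L. K \<in> \<C> \<Longrightarrow> L \<in> \<C> \<Longrightarrow> K \<union> L \<in> \<C>"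
  shows "openin (closed_base_topology S \<C>) = arbitrary union_of (\<lambda>U. \<exists>K\<in>\<C>. U = S - K)"
proof -
  have "istopology (arbitrary union_of (\<lambda>U. \<exists>K\<in>\<C>. U = S - K))"
    by (rule istopology_base) (use assms Diff_Un in metis)
  then show ?thesis
    by (simp add: closed_base_topology_def)
qed

lemma topspace_closed_base_topology:
  assumes "\<And>K L. K \<in> \<C> \<Longrightarrow> L \<in> \<C> \<Longrightarrow> K \<union> L \<in> \<C>" and "{} \<in> \<C>"
  shows "topspace (closed_base_topology S \<C>) = S"
proof -
  have o: "openin (closed_base_topology S \<C>) U
      \<longleftrightarrow> (arbitrary union_of (\<lambda>U. \<exists>K\<in>\<C>. U = S - K)) U" for U
    using openin_closed_base_topology[OF assms(1)] by simp
  have "openin (closed_base_topology S \<C>) S"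
    unfolding o by (rule arbitrary_union_of_inc) (use assms(2) in force)
  moreover have "U \<subseteq> S" if "openin (closed_base_topology S \<C>) U" for U
    using that unfolding o union_of_def by blast
  ultimately show ?thesis
    by (meson openin_topspace openin_subset subset_antisym)
qed

lemma closedin_closed_base_topology:
  assumes "\<And>K L. K \<in> \<C> \<Longrightarrow> L \<in> \<C> \<Longrightarrow> K \<union> L \<in> \<C>" and "{} \<in> \<C>"
  shows "closedin (closed_base_topology S \<C>) A \<longleftrightarrow> (\<exists>\<D>\<subseteq>\<C>. A = S \<inter> \<Inter>\<D>)"
proof -
  have o: "openin (closed_base_topology S \<C>) U
      \<longleftrightarrow> (arbitrary union_of (\<lambda>U. \<exists>K\<in>\<C>. U = S - K)) U" for U
    using openin_closed_base_topology[OF assms(1)] by simp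
  have *: "(arbitrary union_of (\<lambda>U. \<exists>K\<in>\<C>. U = S - K)) (S - A) \<longleftrightarrow> (\<exists>\<D>\<subseteq>\<C>. A = S \<inter> \<Inter>\<D>)"
    if "A \<subseteq> S"
  proof
    assume U: "(arbitrary union_of (\<lambda>U. \<exists>K\<in>\<C>. U = S - K)) (S - A)"
    let ?D = "{K\<in>\<C>. A \<subseteq> K}"
    have "x \<in> A" if x: "x \<in> S" "x \<in> \<Inter>?D" for x
    proof (rule ccontr)
      assume "x \<notin> A"
      then have "x \<in> S - A" using x(1) by simp
      then obtain K where K: "K \<in> \<C>" "x \<in> S - K" "S - K \<subseteq> S - A"
        using U unfolding arbitrary_union_of_alt by metis
      then have "K \<in> ?D" using that \<open>A \<subseteq> S\<close> by auto
      then show False using x(2) K(2) by auto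
    qed
    then have "A = S \<inter> \<Inter>?D" using that by auto
    then show "\<exists>\<D>\<subseteq>\<C>. A = S \<inter> \<Inter>\<D>" by (intro exI[of _ ?D]) simp
  next
    assume "\<exists>\<D>\<subseteq>\<C>. A = S \<inter> \<Inter>\<D>"
    then obtain \<D> where D: "\<D> \<subseteq> \<C>" "A = S \<inter> \<Inter>\<D>" by metis
    have "\<exists>U. (\<exists>K\<in>\<C>. U = S - K) \<and> x \<in> U \<and> U \<subseteq> S - A" if x: "x \<in> S - A" for x
    proof -
      from x obtain K where K: "K \<in> \<D>" "x \<notin> K" using D(2) by auto
      then have "S - K \<subseteq> S - A" using D(2) by auto
      then show ?thesis using K x D(1) by (intro exI[of _ "S - K"]) auto
    qed
    then show "(arbitrary union_of (\<lambda>U. \<exists>K\<in>\<C>. U = S - K)) (S - A)"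
      unfolding arbitrary_union_of_alt by simp
  qed
  have "closedin (closed_base_topology S \<C>) A
      \<longleftrightarrow> A \<subseteq> S \<and> (arbitrary union_of (\<lambda>U. \<exists>K\<in>\<C>. U = S - K)) (S - A)"
    by (simp only: closedin_def topspace_closed_base_topology[OF assms] o)
  also have "\<dots> \<longleftrightarrow> A \<subseteq> S \<and> (\<exists>\<D>\<subseteq>\<C>. A = S \<inter> \<Inter>\<D>)"
    by (rule conj_cong[OF refl *])
  also have "\<dots> \<longleftrightarrow> (\<exists>\<D>\<subseteq>\<C>. A = S \<inter> \<Inter>\<D>)"
    by (metis Int_lower1)
  finally show ?thesis .
qed

definition baire_one :: "'a topology \<Rightarrow> ('a \<Rightarrow> real) \<Rightarrow> bool" where
  "baire_one X f \<longleftrightarrow> (\<exists>g :: nat \<Rightarrow> 'a \<Rightarrow> real.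
     (\<forall>n. continuous_map X euclideanreal (g n)) \<and>
     (\<forall>x\<in>topspace X. (\<lambda>n. g n x) \<longlonglongrightarrow> f x))"

text \<open>A function \<open>X \<rightarrow> \<real>\<close> is represented by its extension with value \<open>undefined\<close> outside \<open>topspace X\<close>,
  so that functions agreeing on \<open>topspace X\<close> are the same ring element.\<close>

definition B1 :: "'a topology \<Rightarrow> ('a \<Rightarrow> real) ring" where
  "B1 X = \<lparr> carrier = {f \<in> extensional (topspace X). baire_one X f},
            mult = (\<lambda>f g. \<lambda>x\<in>topspace X. f x * g x),
            one = (\<lambda>x\<in>topspace X. 1),
            zero = (\<lambda>x\<in>topspace X. 0),
            add = (\<lambda>f g. \<lambda>x\<in>topspace X. f x + g x) \<rparr>"

lemma baire_one_cong:
  "(\<And>x. x \<in> topspace X \<Longrightarrow> f x = g x) \<Longrightarrow> baire_one X f \<longleftrightarrow> baire_one X g"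
  by (simp add: baire_one_def)

lemma baire_one_continuous: "continuous_map X euclideanreal f \<Longrightarrow> baire_one X f"
  unfolding baire_one_def by (rule exI[of _ "\<lambda>n. f"]) auto

lemma baire_one_const: "baire_one X (\<lambda>x. c)"
  by (rule baire_one_continuous) simp

lemma baire_one_add:
  assumes "baire_one X f" "baire_one X g"
  shows "baire_one X (\<lambda>x. f x + g x)"
proof -
  from assms obtain u v where
    "\<forall>n. continuous_map X euclideanreal (u n)" "\<forall>x\<in>topspace X. (\<lambda>n. u n x) \<longlonglongrightarrow> f x"
    "\<forall>n. continuous_map X euclideanreal (v n)" "\<forall>x\<in>topspace X. (\<lambda>n. v n x) \<longlonglongrightarrow> g x"
    unfolding baire_one_def by metis
  then show ?thesis
    unfolding baire_one_def
    by (intro exI[of _ "\<lambda>n x. u n x + v n x"]) (auto intro!: continuous_map_add tendsto_add)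
qed

lemma baire_one_mult:
  assumes "baire_one X f" "baire_one X g"
  shows "baire_one X (\<lambda>x. f x * g x)"
proof -
  from assms obtain u v where
    "\<forall>n. continuous_map X euclideanreal (u n)" "\<forall>x\<in>topspace X. (\<lambda>n. u n x) \<longlonglongrightarrow> f x"
    "\<forall>n. continuous_map X euclideanreal (v n)" "\<forall>x\<in>topspace X. (\<lambda>n. v n x) \<longlonglongrightarrow> g x"
    unfolding baire_one_def by metis
  then show ?thesis
    unfolding baire_one_def
    by (intro exI[of _ "\<lambda>n x. u n x * v n x"]) (auto intro!: continuous_map_real_mult tendsto_mult)
qed

lemma baire_one_restrict:
  "baire_one X (restrict f (topspace X)) \<longleftrightarrow> baire_one X f"
  by (rule baire_one_cong) simp

lemma restrict_in_carrier_B1: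
  "baire_one X f \<Longrightarrow> restrict f (topspace X) \<in> carrier (B1 X)"
  by (simp add: B1_def baire_one_restrict)

lemma cring_B1: "cring (B1 X)"
proof (rule cringI)
  show "abelian_group (B1 X)"
  proof (rule abelian_groupI)
    fix f assume f: "f \<in> carrier (B1 X)"
    let ?g = "\<lambda>x\<in>topspace X. (-1) * f x"
    have "?g \<in> carrier (B1 X)"
      using f by (intro restrict_in_carrier_B1 baire_one_mult baire_one_const) (auto simp: B1_def)
    moreover have "?g \<oplus>\<^bsub>B1 X\<^esub> f = \<zero>\<^bsub>B1 X\<^esub>" by (auto simp: B1_def)
    ultimately show "\<exists>g\<in>carrier (B1 X). g \<oplus>\<^bsub>B1 X\<^esub> f = \<zero>\<^bsub>B1 X\<^esub>" by blast
  qed (auto simp: B1_def baire_one_restrict fun_eq_iff extensional_def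
        intro: baire_one_add baire_one_const)
  show "comm_monoid (B1 X)"
    by (rule comm_monoidI)
      (auto simp: B1_def baire_one_restrict fun_eq_iff extensional_def
        intro: baire_one_mult baire_one_const)
qed (auto simp: B1_def fun_eq_iff distrib_right)

definition structure_space :: "('a, 'm) ring_scheme \<Rightarrow> 'a set topology" where
  "structure_space R =
     closed_base_topology {M. maximalideal M R} {{M. maximalideal M R \<and> f \<in> M} | f. f \<in> carrier R}"

lemma (in cring) structure_space_base:
  defines "\<C> \<equiv> {{M. maximalideal M R \<and> f \<in> M} | f. f \<in> carrier R}"
  shows "K \<in> \<C> \<Longrightarrow> L \<in> \<C> \<Longrightarrow> K \<union> L \<in> \<C>" and "{} \<in> \<C>"
proof -
  assume "K \<in> \<C>" "L \<in> \<C>"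
  then obtain f g where fg: "f \<in> carrier R" "g \<in> carrier R"
    and KL: "K = {M. maximalideal M R \<and> f \<in> M}" "L = {M. maximalideal M R \<and> g \<in> M}"
    by (auto simp: \<C>_def)
  have "f \<otimes> g \<in> M \<longleftrightarrow> f \<in> M \<or> g \<in> M" if M: "maximalideal M R" for M
  proof -
    interpret M: primeideal M R by (rule maximalideal_prime[OF M])
    show ?thesis using fg M.I_prime[OF fg] M.I_l_closed M.I_r_closed by metis
  qed
  then have "K \<union> L = {M. maximalideal M R \<and> f \<otimes> g \<in> M}" unfolding KL by auto
  then show "K \<union> L \<in> \<C>" unfolding \<C>_def mem_Collect_eq using m_closed[OF fg] by metis
next
  have "\<one> \<notin> M" if M: "maximalideal M R" for M
    using ideal.one_imp_carrier[of M R] maximalideal.I_notcarr[OF M] maximalideal.axioms(1)[OF M]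
    by metis
  then have "{} = {M. maximalideal M R \<and> \<one> \<in> M}" by auto
  then show "{} \<in> \<C>" unfolding \<C>_def mem_Collect_eq using one_closed by metis
qed

lemma (in cring) closedin_structure_space:
  "closedin (structure_space R) A \<longleftrightarrow>
     (\<exists>\<D>\<subseteq>{{M. maximalideal M R \<and> f \<in> M} | f. f \<in> carrier R}. A = {M. maximalideal M R} \<inter> \<Inter>\<D>)"
  unfolding structure_space_def
  by (rule closedin_closed_base_topology) (fact structure_space_base)+

lemma (in cring) topspace_structure_space:
  "topspace (structure_space R) = {M. maximalideal M R}"
  unfolding structure_space_def
  by (rule topspace_closed_base_topology) (fact structure_space_base)+

definition zero_set :: "'a topology \<Rightarrow> ('a \<Rightarrow> real) \<Rightarrow> 'a set" where
  "zero_set X f = {x \<in> topspace X. f x = 0}"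

definition ZB_sets :: "'a topology \<Rightarrow> 'a set set" where
  "ZB_sets X = zero_set X ` carrier (B1 X)"

definition ZB_filter :: "'a topology \<Rightarrow> 'a set set \<Rightarrow> bool" where
  "ZB_filter X F \<longleftrightarrow>
     F \<noteq> {} \<and> F \<subseteq> ZB_sets X \<and> {} \<notin> F \<and>
     (\<forall>A\<in>F. \<forall>B\<in>F. A \<inter> B \<in> F) \<and>
     (\<forall>A\<in>F. \<forall>B\<in>ZB_sets X. A \<subseteq> B \<longrightarrow> B \<in> F)"

definition ZB_ultrafilter :: "'a topology \<Rightarrow> 'a set set \<Rightarrow> bool" where
  "ZB_ultrafilter X F \<longleftrightarrow> ZB_filter X F \<and> (\<forall>G. ZB_filter X G \<and> F \<subseteq> G \<longrightarrow> G = F)"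

definition fixed_ZB_ultrafilter :: "'a topology \<Rightarrow> 'a \<Rightarrow> 'a set set" where
  "fixed_ZB_ultrafilter X p = {Z \<in> ZB_sets X. p \<in> Z}"

lemma ZB_sets_eq: "ZB_sets X = {zero_set X f | f. baire_one X f}"
proof -
  have "zero_set X f \<in> ZB_sets X" if "baire_one X f" for f
  proof -
    have "zero_set X f = zero_set X (restrict f (topspace X))"
      by (auto simp: zero_set_def)
    then show ?thesis
      unfolding ZB_sets_def using restrict_in_carrier_B1[OF that] by blast
  qed
  moreover have "baire_one X f" if "f \<in> carrier (B1 X)" for f
    using that by (simp add: B1_def)
  ultimately show ?thesis
    by (auto simp: ZB_sets_def)
qed

lemma zero_set_in_ZB_sets: "baire_one X f \<Longrightarrow> zero_set X f \<in> ZB_sets X"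
  by (auto simp: ZB_sets_eq)

lemma empty_in_ZB_sets: "{} \<in> ZB_sets X"
  using zero_set_in_ZB_sets[OF baire_one_const[of X 1]] by (simp add: zero_set_def)

lemma topspace_in_ZB_sets: "topspace X \<in> ZB_sets X"
  using zero_set_in_ZB_sets[OF baire_one_const[of X 0]] by (simp add: zero_set_def)

lemma ZB_sets_Un:
  assumes "A \<in> ZB_sets X" "B \<in> ZB_sets X" shows "A \<union> B \<in> ZB_sets X"
proof -
  from assms obtain f g where "baire_one X f" "A = zero_set X f" "baire_one X g" "B = zero_set X g"
    unfolding ZB_sets_eq by blast
  moreover have "zero_set X f \<union> zero_set X g = zero_set X (\<lambda>x. f x * g x)"
    by (auto simp: zero_set_def)
  ultimately show ?thesis using zero_set_in_ZB_sets baire_one_mult by metis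
qed

lemma ZB_sets_Int:
  assumes "A \<in> ZB_sets X" "B \<in> ZB_sets X" shows "A \<inter> B \<in> ZB_sets X"
proof -
  from assms obtain f g where "baire_one X f" "A = zero_set X f" "baire_one X g" "B = zero_set X g"
    unfolding ZB_sets_eq by blast
  moreover have "zero_set X f \<inter> zero_set X g = zero_set X (\<lambda>x. f x * f x + g x * g x)"
    by (auto simp: zero_set_def)
  ultimately show ?thesis using zero_set_in_ZB_sets baire_one_mult baire_one_add by metis
qed

lemma ZB_ultrafilter_Un_iff:
  assumes F: "ZB_ultrafilter X F" and A: "A \<in> ZB_sets X" and B: "B \<in> ZB_sets X"
  shows "A \<union> B \<in> F \<longleftrightarrow> A \<in> F \<or> B \<in> F"
proof
  have filt: "ZB_filter X F" using F by (simp add: ZB_ultrafilter_def)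
  then have up: "D \<in> F" if "C \<in> F" "D \<in> ZB_sets X" "C \<subseteq> D" for C D
    using that unfolding ZB_filter_def by blast
  have int: "C \<inter> D \<in> F" if "C \<in> F" "D \<in> F" for C D
    using that filt unfolding ZB_filter_def by blast
  have sub: "F \<subseteq> ZB_sets X" and ne: "F \<noteq> {}" using filt unfolding ZB_filter_def by auto
  {
    assume "A \<in> F \<or> B \<in> F"
    then show "A \<union> B \<in> F" using up[OF _ ZB_sets_Un[OF A B]] by auto
  next
    assume AB: "A \<union> B \<in> F"
    show "A \<in> F \<or> B \<in> F"
    proof (cases "\<exists>C\<in>F. C \<inter> A = {}")
      case True
      then obtain C where C: "C \<in> F" "C \<inter> A = {}" by blast
      then have "C \<inter> (A \<union> B) \<in> F" using int AB by blast
      then show ?thesis using up[OF _ B] C(2) by blast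
    next
      case False
      define G where "G = {Z \<in> ZB_sets X. \<exists>C\<in>F. C \<inter> A \<subseteq> Z}"
      have AG: "A \<in> G" unfolding G_def using A ne by blast
      have FG: "F \<subseteq> G" unfolding G_def using sub by blast
      have "Z \<inter> W \<in> G" if "Z \<in> G" "W \<in> G" for Z W
      proof -
        from that obtain C D where CD: "C \<in> F" "C \<inter> A \<subseteq> Z" "D \<in> F" "D \<inter> A \<subseteq> W"
          unfolding G_def by blast
        then have "(C \<inter> D) \<inter> A \<subseteq> Z \<inter> W" by blast
        moreover have "Z \<inter> W \<in> ZB_sets X" using that ZB_sets_Int unfolding G_def by blast
        ultimately show ?thesis unfolding G_def using int CD by blast
      qed
      moreover have "{} \<notin> G" using False unfolding G_def by blast
      moreover have "W \<in> G" if "Z \<in> G" "W \<in> ZB_sets X" "Z \<subseteq> W" for Z W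
        using that unfolding G_def by blast
      ultimately have "ZB_filter X G"
        unfolding ZB_filter_def using AG by (auto simp: G_def)
      then show ?thesis using F FG AG unfolding ZB_ultrafilter_def by blast
    qed
  }
qed

lemma ZB_ultrafilter_fixed:
  assumes p: "p \<in> topspace X"
  shows "ZB_ultrafilter X (fixed_ZB_ultrafilter X p)"
proof -
  have "ZB_filter X (fixed_ZB_ultrafilter X p)"
    using p topspace_in_ZB_sets[of X] ZB_sets_Int
    unfolding ZB_filter_def fixed_ZB_ultrafilter_def by auto
  moreover have "G \<subseteq> fixed_ZB_ultrafilter X p"
    if G: "ZB_filter X G" "fixed_ZB_ultrafilter X p \<subseteq> G" for G
  proof
    fix Z assume Z: "Z \<in> G"
    then have ZB: "Z \<in> ZB_sets X" using G(1) unfolding ZB_filter_def by blast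
    then obtain f where f: "baire_one X f" "Z = zero_set X f" unfolding ZB_sets_eq by blast
    show "Z \<in> fixed_ZB_ultrafilter X p"
    proof (rule ccontr)
      assume "Z \<notin> fixed_ZB_ultrafilter X p"
      then have np: "f p \<noteq> 0"
        using p f ZB by (simp add: fixed_ZB_ultrafilter_def zero_set_def)
      let ?W = "zero_set X (\<lambda>x. f x + (- f p))"
      have "?W \<in> fixed_ZB_ultrafilter X p"
        unfolding fixed_ZB_ultrafilter_def
        using p zero_set_in_ZB_sets[OF baire_one_add[OF f(1) baire_one_const[of X "- f p"]]]
        by (auto simp: zero_set_def)
      then have "Z \<inter> ?W \<in> G" using G Z unfolding ZB_filter_def by blast
      moreover have "Z \<inter> ?W = {}" using np f(2) by (auto simp: zero_set_def)
      ultimately show False using G(1) unfolding ZB_filter_def by simp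
    qed
  qed
  ultimately show ?thesis unfolding ZB_ultrafilter_def by blast
qed

text \<open>\<open>\<iota>\<close> plays the role of the inclusion of \<open>X\<close> into the index set \<open>Xt\<close>. A literal inclusion is the
  case \<open>\<iota> = id\<close>; an injection is allowed because the type \<open>'a\<close> may have no room for an index set
  larger than \<open>X\<close>.\<close>

definition ZB_index ::
  "'a topology \<Rightarrow> 'b set \<Rightarrow> ('a \<Rightarrow> 'b) \<Rightarrow> ('b \<Rightarrow> 'a set set) \<Rightarrow> bool" where
  "ZB_index X Xt \<iota> \<U> \<longleftrightarrow>
     inj_on \<iota> (topspace X) \<and> \<iota> ` topspace X \<subseteq> Xt \<and>
     bij_betw \<U> Xt {F. ZB_ultrafilter X F} \<and>
     (\<forall>p\<in>topspace X. \<U> (\<iota> p) = fixed_ZB_ultrafilter X p)"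

definition stone_closure :: "'b set \<Rightarrow> ('b \<Rightarrow> 'a set set) \<Rightarrow> 'a set \<Rightarrow> 'b set" where
  "stone_closure Xt \<U> Z = {p \<in> Xt. Z \<in> \<U> p}"

definition stone_topology :: "'a topology \<Rightarrow> 'b set \<Rightarrow> ('b \<Rightarrow> 'a set set) \<Rightarrow> 'b topology" where
  "stone_topology X Xt \<U> = closed_base_topology Xt (stone_closure Xt \<U> ` ZB_sets X)"

lemma stone_topology_base:
  assumes "ZB_index X Xt \<iota> \<U>"
  shows "K \<in> stone_closure Xt \<U> ` ZB_sets X \<Longrightarrow> L \<in> stone_closure Xt \<U> ` ZB_sets X \<Longrightarrow>
           K \<union> L \<in> stone_closure Xt \<U> ` ZB_sets X"
    and "{} \<in> stone_closure Xt \<U> ` ZB_sets X"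
proof -
  have U: "ZB_ultrafilter X (\<U> p)" if "p \<in> Xt" for p
    using assms that unfolding ZB_index_def bij_betw_def by blast
  {
    assume "K \<in> stone_closure Xt \<U> ` ZB_sets X" "L \<in> stone_closure Xt \<U> ` ZB_sets X"
    then obtain A B where AB: "A \<in> ZB_sets X" "B \<in> ZB_sets X"
      "K = stone_closure Xt \<U> A" "L = stone_closure Xt \<U> B" by blast
    then have "K \<union> L = stone_closure Xt \<U> (A \<union> B)"
      using ZB_ultrafilter_Un_iff[OF U] by (auto simp: stone_closure_def)
    then show "K \<union> L \<in> stone_closure Xt \<U> ` ZB_sets X" using ZB_sets_Un AB by (metis imageI)
  next
    have "stone_closure Xt \<U> {} = {}"
      using U unfolding stone_closure_def ZB_ultrafilter_def ZB_filter_def by blast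
    then show "{} \<in> stone_closure Xt \<U> ` ZB_sets X" using empty_in_ZB_sets by (metis imageI)
  }
qed

lemma closedin_stone_topology:
  assumes "ZB_index X Xt \<iota> \<U>"
  shows "closedin (stone_topology X Xt \<U>) A \<longleftrightarrow>
     (\<exists>\<D>\<subseteq>stone_closure Xt \<U> ` ZB_sets X. A = Xt \<inter> \<Inter>\<D>)"
  unfolding stone_topology_def
  by (rule closedin_closed_base_topology) (fact stone_topology_base[OF assms])+

lemma topspace_stone_topology:
  assumes "ZB_index X Xt \<iota> \<U>"
  shows "topspace (stone_topology X Xt \<U>) = Xt"
  unfolding stone_topology_def
  by (rule topspace_closed_base_topology) (fact stone_topology_base[OF assms])+

text \<open>Every Tychonoff space has an index set: the ultrafilters index themselves.\<close>

lemma ZB_index_exists: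
  assumes X: "completely_regular_space X" "Hausdorff_space X"
  shows "ZB_index X {F. ZB_ultrafilter X F} (fixed_ZB_ultrafilter X) id"
proof -
  have "p = q" if p: "p \<in> topspace X" and q: "q \<in> topspace X"
    and eq: "fixed_ZB_ultrafilter X p = fixed_ZB_ultrafilter X q" for p q
  proof (rule ccontr)
    assume "p \<noteq> q"
    have "closedin X {q}"
      using X(2) q by (simp add: closedin_Hausdorff_singleton)
    then obtain f where f: "continuous_map X (top_of_set {0..1::real}) f" "f p = 0" "f q = 1"
      using X(1) p \<open>p \<noteq> q\<close> unfolding completely_regular_space_def by blast
    then have "baire_one X f"
      by (meson baire_one_continuous continuous_map_into_fulltopology)
    then have "zero_set X f \<in> fixed_ZB_ultrafilter X p"
      unfolding fixed_ZB_ultrafilter_def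
      using p f(2) zero_set_in_ZB_sets[of X f] by (auto simp: zero_set_def)
    then have "zero_set X f \<in> fixed_ZB_ultrafilter X q"
      by (simp only: eq)
    then show False
      using f(3) by (simp add: fixed_ZB_ultrafilter_def zero_set_def)
  qed
  then show ?thesis
    unfolding ZB_index_def using ZB_ultrafilter_fixed by (auto intro!: inj_onI)
qed

end

theory Submission
  imports Defs
begin

text \<open>
  A function in \<open>B1 X\<close> is a unit as soon as it has no zero
  (\<open>baire_one_inverse\<close>). Hence the zero sets of a proper ideal never include the
  empty set, and \<open>I \<mapsto> zero_set X ` I\<close> sends proper ideals to \<open>Z\<^sub>B\<close>-filters
  (\<open>ZB_filter_zero_sets_of_ideal\<close>). In the other direction, the functions whose zero set lies in a
  given \<open>Z\<^sub>B\<close>-filter form a proper ideal (\<open>ideal_filter_ideal\<close>). Both maps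
  preserve inclusion; passing from filters to ideals and back is the identity, and passing
  from ideals to filters and back can only enlarge an ideal. Maximal
  objects therefore correspond to maximal objects, and \<open>p \<mapsto> filter_ideal X (\<U> p)\<close> is a bijection
  from the index set onto the maximal ideals.

  Under this bijection \<open>f\<close> belongs to the maximal ideal of \<open>p\<close> exactly when \<open>p\<close> belongs to the
  closure of \<open>zero_set X f\<close>, so the two closed bases are matched with each other, and the bijection
  is a homeomorphism.
\<close>

section \<open>Continuity tested on closed bases\<close>

lemma continuous_map_closed_base_topology:
  assumes C: "\<And>K L. K \<in> \<C> \<Longrightarrow> L \<in> \<C> \<Longrightarrow> K \<union> L \<in> \<C>" "{} \<in> \<C>"
    and D: "\<And>K L. K \<in> \<D> \<Longrightarrow> L \<in> \<D> \<Longrightarrow> K \<union> L \<in> \<D>" "{} \<in> \<D>"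
    and h: "h \<in> S \<rightarrow> T"
    and pre: "\<And>L. L \<in> \<D> \<Longrightarrow> {x \<in> S. h x \<in> L} \<in> \<C>"
  shows "continuous_map (closed_base_topology S \<C>) (closed_base_topology T \<D>) h"
proof -
  have S: "topspace (closed_base_topology S \<C>) = S"
    by (rule topspace_closed_base_topology[OF C])
  have T: "topspace (closed_base_topology T \<D>) = T"
    by (rule topspace_closed_base_topology[OF D])
  have closed: "closedin (closed_base_topology S \<C>) {x \<in> S. h x \<in> A}"
    if A: "closedin (closed_base_topology T \<D>) A" for A
  proof -
    obtain \<E> where E: "\<E> \<subseteq> \<D>" "A = T \<inter> \<Inter>\<E>"
      using closedin_closed_base_topology[OF D, THEN iffD1, OF _ _ A] by blast
    have "{x \<in> S. h x \<in> A} = S \<inter> \<Inter>((\<lambda>L. {x \<in> S. h x \<in> L}) ` \<E>)"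
      using h E(2) by auto
    moreover have "(\<lambda>L. {x \<in> S. h x \<in> L}) ` \<E> \<subseteq> \<C>"
      using pre E(1) by blast
    ultimately show ?thesis
      by (intro closedin_closed_base_topology[OF C, THEN iffD2] exI conjI)
  qed
  have "continuous_map (closed_base_topology S \<C>) (closed_base_topology T \<D>) h \<longleftrightarrow>
      h \<in> S \<rightarrow> T \<and> (\<forall>A. closedin (closed_base_topology T \<D>) A \<longrightarrow>
        closedin (closed_base_topology S \<C>) {x \<in> S. h x \<in> A})"
    by (simp only: continuous_map_closedin S T)
  then show ?thesis
    by (rule iffD2) (intro conjI h allI impI closed)
qed

section \<open>Zero sets and units of the ring of Baire one functions\<close>

text \<open>If \<open>g n \<longlonglongrightarrow> f\<close> pointwise, the quotients \<open>1 / g n\<close> need not be defined, let alone continuous.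
  The damped quotients \<open>g n / ((g n)\<^sup>2 + 1 / (n + 1))\<close> are continuous everywhere, and they tend to
  \<open>f / f\<^sup>2\<close> wherever \<open>f\<close> is nonzero.\<close>

lemma baire_one_inverse:
  assumes "baire_one X f" and nz: "\<And>x. x \<in> topspace X \<Longrightarrow> f x \<noteq> 0"
  shows "baire_one X (\<lambda>x. inverse (f x))"
proof -
  from assms(1) obtain g where g: "\<And>n. continuous_map X euclideanreal (g n)"
    and lim: "\<And>x. x \<in> topspace X \<Longrightarrow> (\<lambda>n. g n x) \<longlonglongrightarrow> f x"
    unfolding baire_one_def by blast
  define u where "u n x = g n x / ((g n x)\<^sup>2 + inverse (real (Suc n)))" for n x
  have pos: "(g n x)\<^sup>2 + inverse (real (Suc n)) \<noteq> 0" for n x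
    using add_nonneg_pos[of "(g n x)\<^sup>2" "inverse (real (Suc n))"] by simp
  have "continuous_map X euclideanreal (u n)" for n
    unfolding u_def
    by (intro continuous_map_real_divide continuous_map_add continuous_map_real_pow g pos) auto
  moreover have "(\<lambda>n. u n x) \<longlonglongrightarrow> inverse (f x)" if x: "x \<in> topspace X" for x
  proof -
    have "(\<lambda>n. u n x) \<longlonglongrightarrow> f x / ((f x)\<^sup>2 + 0)"
      unfolding u_def
      by (intro tendsto_divide tendsto_add tendsto_power lim[OF x] LIMSEQ_inverse_real_of_nat)
        (use nz[OF x] in simp)
    then show ?thesis
      using nz[OF x] by (simp add: power2_eq_square field_simps)
  qed
  ultimately show ?thesis
    unfolding baire_one_def by blast
qed

lemma zero_set_mult:
  "zero_set X (f \<otimes>\<^bsub>B1 X\<^esub> g) = zero_set X f \<union> zero_set X g"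
  by (auto simp: zero_set_def B1_def)

lemma zero_set_add:
  "zero_set X f \<inter> zero_set X g \<subseteq> zero_set X (f \<oplus>\<^bsub>B1 X\<^esub> g)"
  by (auto simp: zero_set_def B1_def)

text \<open>Squares are nonnegative reals, so their sum vanishes only where both terms do.\<close>

lemma zero_set_sum_squares:
  "zero_set X (f \<otimes>\<^bsub>B1 X\<^esub> f \<oplus>\<^bsub>B1 X\<^esub> g \<otimes>\<^bsub>B1 X\<^esub> g) = zero_set X f \<inter> zero_set X g"
  by (auto simp: zero_set_def B1_def)

lemma zero_set_zero: "zero_set X \<zero>\<^bsub>B1 X\<^esub> = topspace X"
  by (auto simp: zero_set_def B1_def)

lemma zero_set_one: "zero_set X \<one>\<^bsub>B1 X\<^esub> = {}"
  by (auto simp: zero_set_def B1_def)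

lemma one_in_ideal_of_empty_zero_set:
  assumes I: "ideal I (B1 X)" and f: "f \<in> I" and Z: "zero_set X f = {}"
  shows "\<one>\<^bsub>B1 X\<^esub> \<in> I"
proof -
  interpret I: ideal I "B1 X" by (rule I)
  have fc: "f \<in> carrier (B1 X)" using f by (rule I.Icarr)
  have nz: "f x \<noteq> 0" if "x \<in> topspace X" for x
    using Z that by (auto simp: zero_set_def)
  let ?g = "restrict (\<lambda>x. inverse (f x)) (topspace X)"
  have "?g \<in> carrier (B1 X)"
    using fc nz by (intro restrict_in_carrier_B1 baire_one_inverse) (auto simp: B1_def)
  then have "?g \<otimes>\<^bsub>B1 X\<^esub> f \<in> I" using f by (rule I.I_l_closed[rotated])
  moreover have "?g \<otimes>\<^bsub>B1 X\<^esub> f = \<one>\<^bsub>B1 X\<^esub>" using nz by (auto simp: B1_def)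
  ultimately show ?thesis by simp
qed

section \<open>Ideals and filters of zero sets\<close>

lemma ZB_filter_zero_sets_of_ideal:
  assumes I: "ideal I (B1 X)" and proper: "I \<noteq> carrier (B1 X)"
  shows "ZB_filter X (zero_set X ` I)"
proof -
  interpret I: ideal I "B1 X" by (rule I)
  have "zero_set X f \<inter> zero_set X g \<in> zero_set X ` I" if "f \<in> I" "g \<in> I" for f g
  proof -
    have "f \<otimes>\<^bsub>B1 X\<^esub> f \<oplus>\<^bsub>B1 X\<^esub> g \<otimes>\<^bsub>B1 X\<^esub> g \<in> I"
      using that I.Icarr by (simp add: I.a_closed I.I_l_closed)
    then show ?thesis
      using zero_set_sum_squares by (metis imageI)
  qed
  moreover have "B \<in> zero_set X ` I"
    if f: "f \<in> I" and B: "B \<in> ZB_sets X" and sub: "zero_set X f \<subseteq> B" for f B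
  proof -
    from B obtain g where g: "g \<in> carrier (B1 X)" "B = zero_set X g"
      unfolding ZB_sets_def by blast
    have "zero_set X (f \<otimes>\<^bsub>B1 X\<^esub> g) = B"
      using sub g(2) by (simp add: zero_set_mult Un_absorb1)
    moreover have "f \<otimes>\<^bsub>B1 X\<^esub> g \<in> I"
      using f g(1) by (rule I.I_r_closed)
    ultimately show ?thesis by blast
  qed
  moreover have "{} \<notin> zero_set X ` I"
    using one_in_ideal_of_empty_zero_set[OF I] I.one_imp_carrier proper by (metis imageE)
  moreover have "zero_set X ` I \<subseteq> ZB_sets X"
    unfolding ZB_sets_def using I.Icarr by blast
  moreover have "zero_set X ` I \<noteq> {}"
    using additive_subgroup.zero_closed[OF I.additive_subgroup_axioms] by blast
  ultimately show ?thesis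
    unfolding ZB_filter_def by (intro conjI ballI impI) auto
qed

definition filter_ideal :: "'a topology \<Rightarrow> 'a set set \<Rightarrow> ('a \<Rightarrow> real) set" where
  "filter_ideal X F = {f \<in> carrier (B1 X). zero_set X f \<in> F}"

lemma zero_sets_filter_ideal: "F \<subseteq> ZB_sets X \<Longrightarrow> zero_set X ` filter_ideal X F = F"
  by (auto simp: filter_ideal_def ZB_sets_def)

lemma ideal_filter_ideal:
  assumes F: "ZB_filter X F"
  shows "ideal (filter_ideal X F) (B1 X)" and "filter_ideal X F \<noteq> carrier (B1 X)"
proof -
  interpret R: cring "B1 X" by (rule cring_B1)
  have zero_in: "zero_set X f \<in> ZB_sets X" if "f \<in> carrier (B1 X)" for f
    using that unfolding ZB_sets_def by blast
  have up: "B \<in> F" if "A \<in> F" "B \<in> ZB_sets X" "A \<subseteq> B" for A B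
    using F that unfolding ZB_filter_def by blast
  have int: "A \<inter> B \<in> F" if "A \<in> F" "B \<in> F" for A B
    using F that unfolding ZB_filter_def by blast
  have mult: "g \<otimes>\<^bsub>B1 X\<^esub> f \<in> filter_ideal X F"
    if "f \<in> filter_ideal X F" "g \<in> carrier (B1 X)" for f g
    using that up[of "zero_set X f" "zero_set X (g \<otimes>\<^bsub>B1 X\<^esub> f)"] zero_in[of "g \<otimes>\<^bsub>B1 X\<^esub> f"]
    by (auto simp: filter_ideal_def zero_set_mult)
  have add: "f \<oplus>\<^bsub>B1 X\<^esub> g \<in> filter_ideal X F"
    if "f \<in> filter_ideal X F" "g \<in> filter_ideal X F" for f g
    using that up[OF int zero_in zero_set_add] by (auto simp: filter_ideal_def)
  have neg: "\<ominus>\<^bsub>B1 X\<^esub> f \<in> filter_ideal X F" if "f \<in> filter_ideal X F" for f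
  proof -
    have "f \<in> carrier (B1 X)" using that by (simp add: filter_ideal_def)
    then have "\<ominus>\<^bsub>B1 X\<^esub> f = (\<ominus>\<^bsub>B1 X\<^esub> \<one>\<^bsub>B1 X\<^esub>) \<otimes>\<^bsub>B1 X\<^esub> f"
      by (simp add: R.l_minus)
    then show ?thesis using mult[OF that] by simp
  qed
  obtain A where A: "A \<in> F"
    using F unfolding ZB_filter_def by auto
  then have "A \<in> ZB_sets X"
    using F unfolding ZB_filter_def by auto
  then have "A \<subseteq> topspace X"
    by (auto simp: ZB_sets_def zero_set_def)
  with A have "topspace X \<in> F"
    by (rule up[OF _ topspace_in_ZB_sets])
  then have zero: "\<zero>\<^bsub>B1 X\<^esub> \<in> filter_ideal X F"
    by (simp add: filter_ideal_def zero_set_zero)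
  show "ideal (filter_ideal X F) (B1 X)"
  proof (rule idealI)
    show "subgroup (filter_ideal X F) (add_monoid (B1 X))"
      by (rule R.add.subgroupI)
        (use zero add neg in \<open>auto simp: filter_ideal_def a_inv_def\<close>)
    show "ring (B1 X)"
      by (rule R.ring_axioms)
    show "g \<otimes>\<^bsub>B1 X\<^esub> f \<in> filter_ideal X F"
      if "f \<in> filter_ideal X F" "g \<in> carrier (B1 X)" for f g
      using that by (rule mult)
    show "f \<otimes>\<^bsub>B1 X\<^esub> g \<in> filter_ideal X F"
      if "f \<in> filter_ideal X F" "g \<in> carrier (B1 X)" for f g
      using mult[OF that] that R.m_comm[of f g] by (simp add: filter_ideal_def)
  qed
  have "\<one>\<^bsub>B1 X\<^esub> \<notin> filter_ideal X F"
    using F by (simp add: filter_ideal_def zero_set_one ZB_filter_def)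
  then show "filter_ideal X F \<noteq> carrier (B1 X)"
    using R.one_closed by metis
qed

section \<open>Maximal ideals and ultrafilters\<close>

text \<open>A proper ideal above \<open>filter_ideal X F\<close> has a filter of zero sets above \<open>F\<close>, hence equal to
  \<open>F\<close> by maximality; so the ideal was not larger after all.\<close>

lemma maximalideal_filter_ideal:
  assumes F: "ZB_ultrafilter X F"
  shows "maximalideal (filter_ideal X F) (B1 X)"
proof -
  have filt: "ZB_filter X F" using F by (simp add: ZB_ultrafilter_def)
  have sub: "F \<subseteq> ZB_sets X" using filt by (simp add: ZB_filter_def)
  show ?thesis
  proof (rule maximalidealI)
    show "ideal (filter_ideal X F) (B1 X)" by (rule ideal_filter_ideal(1)[OF filt])
    show "carrier (B1 X) \<noteq> filter_ideal X F" using ideal_filter_ideal(2)[OF filt] by metis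
    fix J assume J: "ideal J (B1 X)" "filter_ideal X F \<subseteq> J" "J \<subseteq> carrier (B1 X)"
    show "J = filter_ideal X F \<or> J = carrier (B1 X)"
    proof (rule disjCI)
      assume "J \<noteq> carrier (B1 X)"
      then have "ZB_filter X (zero_set X ` J)" using J(1) by (rule ZB_filter_zero_sets_of_ideal[rotated])
      moreover have "F \<subseteq> zero_set X ` J"
        using J(2) zero_sets_filter_ideal[OF sub] by blast
      ultimately have "zero_set X ` J = F" using F unfolding ZB_ultrafilter_def by blast
      then show "J = filter_ideal X F" using J(2,3) unfolding filter_ideal_def by blast
    qed
  qed
qed

text \<open>A maximal ideal \<open>M\<close> lies inside the proper ideal \<open>filter_ideal X G\<close> for every filter \<open>G\<close>
  above \<open>zero_set X ` M\<close>, hence equals it. For \<open>G = zero_set X ` M\<close> this is the second claim, and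
  for general \<open>G\<close> it recovers \<open>G\<close> from \<open>M\<close>, which is the maximality of \<open>zero_set X ` M\<close>.\<close>

lemma ZB_ultrafilter_zero_sets_of_maximalideal:
  assumes M: "maximalideal M (B1 X)"
  shows "ZB_ultrafilter X (zero_set X ` M)" and "filter_ideal X (zero_set X ` M) = M"
proof -
  interpret M: maximalideal M "B1 X" by (rule M)
  have filt: "ZB_filter X (zero_set X ` M)"
    by (rule ZB_filter_zero_sets_of_ideal[OF M.is_ideal M.I_notcarr[symmetric]])
  have eq: "filter_ideal X G = M" if G: "ZB_filter X G" "zero_set X ` M \<subseteq> G" for G
  proof -
    have "M \<subseteq> filter_ideal X G"
      using G(2) M.Icarr unfolding filter_ideal_def by blast
    moreover have "filter_ideal X G \<subseteq> carrier (B1 X)"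
      unfolding filter_ideal_def by blast
    ultimately show ?thesis
      using M.I_maximal[OF ideal_filter_ideal(1)[OF G(1)]] ideal_filter_ideal(2)[OF G(1)] by blast
  qed
  show "filter_ideal X (zero_set X ` M) = M"
    by (rule eq[OF filt subset_refl])
  have "G = zero_set X ` M" if "ZB_filter X G" "zero_set X ` M \<subseteq> G" for G
    using eq[OF that] zero_sets_filter_ideal[of G X] that(1) unfolding ZB_filter_def by metis
  then show "ZB_ultrafilter X (zero_set X ` M)"
    unfolding ZB_ultrafilter_def using filt by blast
qed

lemma bij_betw_filter_ideal:
  "bij_betw (filter_ideal X) {F. ZB_ultrafilter X F} {M. maximalideal M (B1 X)}"
proof (rule bij_betw_byWitness[where f' = "\<lambda>M. zero_set X ` M"])
  show "\<forall>F\<in>{F. ZB_ultrafilter X F}. zero_set X ` filter_ideal X F = F"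
    by (simp add: zero_sets_filter_ideal ZB_ultrafilter_def ZB_filter_def)
  show "\<forall>M\<in>{M. maximalideal M (B1 X)}. filter_ideal X (zero_set X ` M) = M"
    using ZB_ultrafilter_zero_sets_of_maximalideal(2) by blast
  show "filter_ideal X ` {F. ZB_ultrafilter X F} \<subseteq> {M. maximalideal M (B1 X)}"
    using maximalideal_filter_ideal by blast
  show "(\<lambda>M. zero_set X ` M) ` {M. maximalideal M (B1 X)} \<subseteq> {F. ZB_ultrafilter X F}"
    using ZB_ultrafilter_zero_sets_of_maximalideal(1) by blast
qed

section \<open>The homeomorphism\<close>

theorem theorem3p2:
  fixes X :: "'a topology" and Xt :: "'b set"
    and \<iota> :: "'a \<Rightarrow> 'b" and \<U> :: "'b \<Rightarrow> 'a set set"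
  assumes "completely_regular_space X" and "Hausdorff_space X"
    and "ZB_index X Xt \<iota> \<U>"
  shows "structure_space (B1 X) homeomorphic_space stone_topology X Xt \<U>"
proof -
  interpret R: cring "B1 X" by (rule cring_B1)
  let ?Max = "{M. maximalideal M (B1 X)}"
  let ?C = "{{M. maximalideal M (B1 X) \<and> f \<in> M} | f. f \<in> carrier (B1 X)}"
  let ?D = "stone_closure Xt \<U> ` ZB_sets X"
  define h where "h = filter_ideal X \<circ> \<U>"
  define k where "k = inv_into Xt h"
  have bij: "bij_betw h Xt ?Max"
    unfolding h_def using assms(3) bij_betw_filter_ideal bij_betw_trans
    unfolding ZB_index_def by metis
  have kh: "k (h p) = p" if "p \<in> Xt" for p
    using bij_betw_inv_into_left[OF bij that] by (simp add: k_def)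
  have hk: "h (k M) = M" if "M \<in> ?Max" for M
    using bij_betw_inv_into_right[OF bij that] by (simp add: k_def)
  have h_in: "h \<in> Xt \<rightarrow> ?Max" using bij by (rule bij_betw_imp_funcset)
  have k_in: "k \<in> ?Max \<rightarrow> Xt"
    using bij_betw_inv_into[OF bij] unfolding k_def by (rule bij_betw_imp_funcset)
  have mem: "f \<in> h p \<longleftrightarrow> zero_set X f \<in> \<U> p" if "f \<in> carrier (B1 X)" for f p
    using that by (simp add: h_def filter_ideal_def)
  have pre_h: "{p \<in> Xt. h p \<in> K} \<in> ?D" if "K \<in> ?C" for K
  proof -
    from that obtain f where f: "f \<in> carrier (B1 X)" "K = {M. maximalideal M (B1 X) \<and> f \<in> M}"
      by blast
    then have "{p \<in> Xt. h p \<in> K} = stone_closure Xt \<U> (zero_set X f)"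
      using h_in mem by (auto simp: stone_closure_def)
    then show ?thesis using f(1) by (auto simp: ZB_sets_def)
  qed
  have pre_k: "{M \<in> ?Max. k M \<in> L} \<in> ?C" if "L \<in> ?D" for L
  proof -
    from that obtain f where f: "f \<in> carrier (B1 X)" "L = stone_closure Xt \<U> (zero_set X f)"
      unfolding ZB_sets_def by blast
    have "k M \<in> L \<longleftrightarrow> f \<in> M" if "M \<in> ?Max" for M
      using mem[OF f(1), of "k M"] hk[OF that] k_in that f(2) by (auto simp: stone_closure_def)
    then have "{M \<in> ?Max. k M \<in> L} = {M. maximalideal M (B1 X) \<and> f \<in> M}" by blast
    then show ?thesis using f(1) by blast
  qed
  note C = R.structure_space_base and D = stone_topology_base[OF assms(3)]
  have "continuous_map (structure_space (B1 X)) (stone_topology X Xt \<U>) k"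
    unfolding structure_space_def stone_topology_def
    by (rule continuous_map_closed_base_topology[OF C D k_in pre_k])
  moreover have "continuous_map (stone_topology X Xt \<U>) (structure_space (B1 X)) h"
    unfolding structure_space_def stone_topology_def
    by (rule continuous_map_closed_base_topology[OF D C h_in pre_h])
  ultimately have "homeomorphic_maps (structure_space (B1 X)) (stone_topology X Xt \<U>) k h"
    unfolding homeomorphic_maps_def R.topspace_structure_space topspace_stone_topology[OF assms(3)]
    using hk kh by blast
  then show ?thesis
    unfolding homeomorphic_space_def by blast
qed

end
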